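(* Let $k$ and $n$ be arbitrary positive integers with $k\ge n$. If $k$ distinct IDs are assignable to the $n$ nodes of the ring, then any (deterministic, uniform, terminating) content-oblivious leader election algorithm sends at least $n\lfloor\log(k/n)\rfloor$ pulses for some assignment of distinct IDs to the nodes (and some execution). In particular, if the supply of assignable IDs is infinite, the number of pulses sent is unbounded, even on rings with just a single node.
   Context: Content-oblivious model: a ring of $n\ge 1$ nodes (for $n=1$ the single node's two ports are joined by a channel to each other), each node with two ports; messages are content-free pulses; the network is asynchronous (arbitrary finite delays, no loss or injection); nodes are event-driven and act only based on their own ID and the sequence of pulses received (with port of arrival). Algorithms are uniform: nodes do not know $n$. Leader election: every node terminates with output Leader or Non-Leader, exactly one node outputting Leader. Logarithms are binary. *)

theory Defs
  imports Complex_Main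
begin

datatype port = Port0 | Port1

fun other :: "port \<Rightarrow> port" where
  "other Port0 = Port1"
| "other Port1 = Port0"

datatype verdict = Leader | NonLeader

text \<open>
  A deterministic event-driven algorithm sees only the node's own ID and its history, the list of
  ports at which pulses have arrived so far (oldest first); the ring size is not an argument.
  \<open>sends A v h p\<close> is the number of pulses emitted through port \<open>p\<close> in reaction to the last event of
  the history \<open>h\<close>, where \<open>h = []\<close> is the start-up event.  \<open>decide A v h = Some d\<close> means that the node
  terminates with output \<open>d\<close> (after the emissions of the same event).
\<close>

record 'id algorithm =
  sends :: "'id \<Rightarrow> port list \<Rightarrow> port \<Rightarrow> nat"
  decide :: "'id \<Rightarrow> port list \<Rightarrow> verdict option"

text \<open>
  The nodes of a ring are \<open>0, \<dots>, n - 1\<close> in clockwise order.  A port labelling \<open>fl\<close> tells for every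
  node whether its two ports are swapped: the clockwise port of node \<open>i\<close> is \<open>Port1\<close> unless \<open>fl i\<close>.
  \<open>link n fl (i, p)\<close> is the node and port at which a pulse emitted by \<open>i\<close> through \<open>p\<close> arrives.  For
  \<open>n = 1\<close> it joins the two ports of the only node; for \<open>n = 2\<close> there are two parallel channels.
\<close>

type_synonym labelling = "nat \<Rightarrow> bool"

definition oriented :: labelling where
  "oriented = (\<lambda>_. False)"

definition cw_port :: "labelling \<Rightarrow> nat \<Rightarrow> port" where
  "cw_port fl i = (if fl i then Port0 else Port1)"

definition link :: "nat \<Rightarrow> labelling \<Rightarrow> nat \<times> port \<Rightarrow> nat \<times> port" where
  "link n fl = (\<lambda>(i, p).
     if p = cw_port fl i
     then (let j = (i + 1) mod n in (j, other (cw_port fl j)))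
     else (let j = (i + n - 1) mod n in (j, cw_port fl j)))"

text \<open>
  \<open>transit c j q\<close> is the number of pulses on their way to port \<open>q\<close> of node \<open>j\<close>.  Pulses carry no
  content, so counting them describes a channel completely.  \<open>sent c\<close> is the number of pulses emitted
  so far by all nodes together.
\<close>

record config =
  hist :: "nat \<Rightarrow> port list"
  transit :: "nat \<Rightarrow> port \<Rightarrow> nat"
  sent :: nat

definition emitted_to ::
  "'id algorithm \<Rightarrow> nat \<Rightarrow> labelling \<Rightarrow> (nat \<Rightarrow> 'id) \<Rightarrow> nat \<Rightarrow> port list \<Rightarrow> nat \<Rightarrow> port \<Rightarrow> nat" where
  "emitted_to A n fl ids i h j q =
     (\<Sum>p\<in>{Port0, Port1}. if link n fl (i, p) = (j, q) then sends A (ids i) h p else 0)"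

definition emitted :: "'id algorithm \<Rightarrow> (nat \<Rightarrow> 'id) \<Rightarrow> nat \<Rightarrow> port list \<Rightarrow> nat" where
  "emitted A ids i h = (\<Sum>p\<in>{Port0, Port1}. sends A (ids i) h p)"

definition node_output ::
  "'id algorithm \<Rightarrow> (nat \<Rightarrow> 'id) \<Rightarrow> config \<Rightarrow> nat \<Rightarrow> verdict option" where
  "node_output A ids c i = decide A (ids i) (hist c i)"

definition initial :: "'id algorithm \<Rightarrow> nat \<Rightarrow> labelling \<Rightarrow> (nat \<Rightarrow> 'id) \<Rightarrow> config" where
  "initial A n fl ids =
     \<lparr> hist = (\<lambda>_. []),
       transit = (\<lambda>j q. \<Sum>i<n. emitted_to A n fl ids i [] j q),
       sent = (\<Sum>i<n. emitted A ids i []) \<rparr>"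

text \<open>
  A terminated node discards the pulses it still receives, so its history, and hence its output,
  no longer changes.
\<close>

definition deliver ::
  "'id algorithm \<Rightarrow> nat \<Rightarrow> labelling \<Rightarrow> (nat \<Rightarrow> 'id) \<Rightarrow> nat \<Rightarrow> port \<Rightarrow> config \<Rightarrow> config" where
  "deliver A n fl ids i p c =
     (let rest = (transit c)(i := (transit c i)(p := transit c i p - 1));
          h = hist c i @ [p]
      in if node_output A ids c i \<noteq> None then c\<lparr>transit := rest\<rparr>
         else \<lparr> hist = (hist c)(i := h),
                transit = (\<lambda>j q. rest j q + emitted_to A n fl ids i h j q),
                sent = sent c + emitted A ids i h \<rparr>)"

text \<open>
  The algorithm being deterministic, an execution is determined by the schedule of deliveries.  An
  entry \<open>None\<close> is an idle step, so finite executions are covered as well.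
\<close>

type_synonym schedule = "nat \<Rightarrow> (nat \<times> port) option"

primrec run ::
  "'id algorithm \<Rightarrow> nat \<Rightarrow> labelling \<Rightarrow> (nat \<Rightarrow> 'id) \<Rightarrow> schedule \<Rightarrow> nat \<Rightarrow> config" where
  "run A n fl ids sch 0 = initial A n fl ids"
| "run A n fl ids sch (Suc t) =
     (case sch t of
        None \<Rightarrow> run A n fl ids sch t
      | Some (i, p) \<Rightarrow> deliver A n fl ids i p (run A n fl ids sch t))"

text \<open>
  The first conjunct excludes injection of pulses (only pulses in transit are delivered), the second
  one excludes loss (every pulse arrives after a finite, unbounded delay).
\<close>

definition admissible ::
  "'id algorithm \<Rightarrow> nat \<Rightarrow> labelling \<Rightarrow> (nat \<Rightarrow> 'id) \<Rightarrow> schedule \<Rightarrow> bool" where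
  "admissible A n fl ids sch \<longleftrightarrow>
     (\<forall>t i p. sch t = Some (i, p) \<longrightarrow> i < n \<and> transit (run A n fl ids sch t) i p > 0) \<and>
     (\<forall>t i p. i < n \<and> transit (run A n fl ids sch t) i p > 0 \<longrightarrow> (\<exists>t'\<ge>t. sch t' = Some (i, p)))"

definition id_assignment :: "nat \<Rightarrow> 'id set \<Rightarrow> (nat \<Rightarrow> 'id) \<Rightarrow> bool" where
  "id_assignment n IDs ids \<longleftrightarrow> inj_on ids {..<n} \<and> ids ` {..<n} \<subseteq> IDs"

definition elects_leader ::
  "'id algorithm \<Rightarrow> nat \<Rightarrow> labelling \<Rightarrow> (nat \<Rightarrow> 'id) \<Rightarrow> schedule \<Rightarrow> bool" where
  "elects_leader A n fl ids sch \<longleftrightarrow>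
     (\<exists>t. (\<forall>i<n. node_output A ids (run A n fl ids sch t) i \<noteq> None) \<and>
          (\<exists>!i. i < n \<and> node_output A ids (run A n fl ids sch t) i = Some Leader))"

text \<open>
  Correctness on rings of every size whose port labelling belongs to \<open>Lab\<close>: oriented rings are
  \<open>Lab = {oriented}\<close>, arbitrarily labelled rings are \<open>Lab = UNIV\<close>.
\<close>

definition leader_election_algorithm :: "'id algorithm \<Rightarrow> labelling set \<Rightarrow> 'id set \<Rightarrow> bool" where
  "leader_election_algorithm A Lab IDs \<longleftrightarrow>
     (\<forall>n fl ids sch. n \<ge> 1 \<and> fl \<in> Lab \<and> id_assignment n IDs ids \<and> admissible A n fl ids sch
        \<longrightarrow> elects_leader A n fl ids sch)"

definition sends_at_least ::
  "'id algorithm \<Rightarrow> nat \<Rightarrow> labelling \<Rightarrow> (nat \<Rightarrow> 'id) \<Rightarrow> schedule \<Rightarrow> nat \<Rightarrow> bool" where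
  "sends_at_least A n fl ids sch N \<longleftrightarrow> (\<exists>t. N \<le> sent (run A n fl ids sch t))"

end

theory Submission
  imports Defs
begin

text \<open>
  Fix for every ID \<open>v\<close> a fair execution on the ring with the single node \<open>v\<close>, and let the solitude
  word of \<open>v\<close> be the sequence of ports at which \<open>v\<close> receives pulses until it terminates (as the
  leader).  If all nodes of a larger ring have IDs whose solitude words start with the same word
  \<open>w\<close>, then delivering \<open>w\<close> in lockstep to all nodes is a legal execution: each node has received
  as many pulses as its neighbour, so that the channel between them holds what the neighbour's own
  loop would hold.  Hence solitude words are distinct, as two nodes with the same solitude word
  would both become leader on a ring of two.  Fewer than \<open>2 ^ L\<close> IDs have a solitude word
  shorter than \<open>L\<close>, so among \<open>n * 2 ^ L\<close> IDs there are \<open>n\<close> whose solitude words share a prefix of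
  length \<open>L\<close>.  On the ring formed by them, \<open>n * L\<close> pulses are received in lockstep.
\<close>

section \<open>Reachable configurations and fair schedules\<close>

text \<open>Timing and fairness are left out: an execution can be built delivery by delivery and
  turned into an admissible schedule afterwards.\<close>

inductive reachable ::
  "'id algorithm \<Rightarrow> nat \<Rightarrow> labelling \<Rightarrow> (nat \<Rightarrow> 'id) \<Rightarrow> config \<Rightarrow> bool"
  for A n fl ids where
  reachable_initial: "reachable A n fl ids (initial A n fl ids)"
| reachable_deliver: "reachable A n fl ids c \<Longrightarrow> i < n \<Longrightarrow> transit c i p > 0 \<Longrightarrow>
    reachable A n fl ids (deliver A n fl ids i p c)"

definition legal_upto ::
  "'id algorithm \<Rightarrow> nat \<Rightarrow> labelling \<Rightarrow> (nat \<Rightarrow> 'id) \<Rightarrow> schedule \<Rightarrow> nat \<Rightarrow> bool" where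
  "legal_upto A n fl ids sch T \<longleftrightarrow>
     (\<forall>t<T. \<forall>i p. sch t = Some (i, p) \<longrightarrow> i < n \<and> transit (run A n fl ids sch t) i p > 0)"

lemma run_cong:
  "(\<And>s. s < t \<Longrightarrow> sch s = sch' s) \<Longrightarrow> run A n fl ids sch t = run A n fl ids sch' t"
  by (induction t) (auto split: option.splits)

lemma reachable_imp_legal_upto:
  assumes "reachable A n fl ids c"
  shows "\<exists>sch T. legal_upto A n fl ids sch T \<and> run A n fl ids sch T = c"
  using assms
proof induction
  case reachable_initial
  have "legal_upto A n fl ids (\<lambda>_. None) 0" by (simp add: legal_upto_def)
  then show ?case by (metis run.simps(1))
next
  case (reachable_deliver c i p)
  then obtain sch T where sch: "legal_upto A n fl ids sch T" "run A n fl ids sch T = c" by blast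
  define sch' where "sch' = sch(T := Some (i, p))"
  have eq: "run A n fl ids sch' t = run A n fl ids sch t" if "t \<le> T" for t
    by (rule run_cong) (use that in \<open>simp add: sch'_def\<close>)
  have "legal_upto A n fl ids sch' (Suc T)"
    unfolding legal_upto_def
  proof (intro allI impI)
    fix t j q assume t: "t < Suc T" "sch' t = Some (j, q)"
    then show "j < n \<and> transit (run A n fl ids sch' t) j q > 0"
      using sch reachable_deliver.hyps eq[of t]
      by (cases "t = T") (auto simp: sch'_def legal_upto_def less_Suc_eq)
  qed
  moreover have "run A n fl ids sch' (Suc T) = deliver A n fl ids i p c"
    using eq[of T] sch(2) by (simp add: sch'_def)
  ultimately show ?case by blast
qed

text \<open>Runs through all \<open>2 * n\<close> pairs of node and port with period
  \<open>2 * n\<close>, so that each of them recurs forever.\<close>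

definition channel :: "nat \<Rightarrow> nat \<Rightarrow> nat \<times> port" where
  "channel n t = (t div 2 mod n, if even t then Port0 else Port1)"

definition round_robin :: "nat \<Rightarrow> nat \<Rightarrow> config \<Rightarrow> (nat \<times> port) option" where
  "round_robin n t c = (case channel n t of (i, p) \<Rightarrow>
     if transit c i p > 0 then Some (i, p) else None)"

lemma channel_recurs:
  assumes "i < n"
  shows "\<exists>t\<ge>s. channel n t = (i, p)"
proof (cases p)
  case Port0
  have "channel n (2 * (s * n + i)) = (i, p)" using assms Port0 by (simp add: channel_def)
  moreover have "s \<le> 2 * (s * n + i)" using assms by (cases n) auto
  ultimately show ?thesis by blast
next
  case Port1
  have "channel n (2 * (s * n + i) + 1) = (i, p)" using assms Port1 by (simp add: channel_def)
  moreover have "s \<le> 2 * (s * n + i) + 1" using assms by (cases n) auto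
  ultimately show ?thesis by blast
qed

text \<open>A fair schedule has to look at the current configuration, which itself depends on the
  schedule. Recursion on configurations breaks this circle.\<close>

primrec run_adaptive ::
  "'id algorithm \<Rightarrow> nat \<Rightarrow> labelling \<Rightarrow> (nat \<Rightarrow> 'id) \<Rightarrow> (nat \<Rightarrow> config \<Rightarrow> (nat \<times> port) option) \<Rightarrow>
     nat \<Rightarrow> config" where
  "run_adaptive A n fl ids f 0 = initial A n fl ids"
| "run_adaptive A n fl ids f (Suc t) =
     (case f t (run_adaptive A n fl ids f t) of
        None \<Rightarrow> run_adaptive A n fl ids f t
      | Some (i, p) \<Rightarrow> deliver A n fl ids i p (run_adaptive A n fl ids f t))"

lemma run_eq_run_adaptive:
  assumes "\<forall>t. sch t = f t (run_adaptive A n fl ids f t)"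
  shows "run A n fl ids sch t = run_adaptive A n fl ids f t"
proof (induction t)
  case (Suc t)
  show ?case unfolding run.simps run_adaptive.simps Suc assms[rule_format, of t] ..
qed simp

lemma transit_le_deliver:
  "(j, q) \<noteq> (i, p) \<Longrightarrow> transit c j q \<le> transit (deliver A n fl ids i p c) j q"
  by (auto simp: deliver_def Let_def)

lemma transit_persists:
  assumes "transit (run A n fl ids sch t) i p > 0" "t \<le> s"
    and "\<And>r. t \<le> r \<Longrightarrow> r < s \<Longrightarrow> sch r \<noteq> Some (i, p)"
  shows "transit (run A n fl ids sch s) i p > 0"
  using assms(2,3)
proof (induction s rule: dec_induct)
  case base
  then show ?case using assms(1) by simp
next
  case (step s)
  then have "transit (run A n fl ids sch s) i p > 0" "sch s \<noteq> Some (i, p)" by auto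
  then show ?case
    by (auto split: option.splits intro!: less_le_trans[OF _ transit_le_deliver])
qed

text \<open>From time \<open>T\<close> on, the channels are served in turn, idling on empty ones. A
  waiting pulse stays in transit until its channel is served, so none waits forever.\<close>

lemma legal_upto_extends_to_admissible:
  assumes "legal_upto A n fl ids sch T" "n \<ge> 1"
  shows "\<exists>sch'. admissible A n fl ids sch' \<and> run A n fl ids sch' T = run A n fl ids sch T"
proof -
  define f where "f t c = (if t < T then sch t else round_robin n t c)" for t c
  define sch' where "sch' t = f t (run_adaptive A n fl ids f t)" for t
  have sch': "sch' t = f t (run A n fl ids sch' t)" for t
    using run_eq_run_adaptive[of sch' f A n fl ids t] unfolding sch'_def by simp
  have eq: "run A n fl ids sch' t = run A n fl ids sch t" if "t \<le> T" for t
    by (rule run_cong) (use that in \<open>simp add: sch' f_def\<close>)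
  have "i < n \<and> transit (run A n fl ids sch' t) i p > 0" if "sch' t = Some (i, p)" for t i p
  proof (cases "t < T")
    case True
    then show ?thesis using that assms eq[of t] sch'[of t] by (simp add: legal_upto_def f_def)
  next
    case False
    then show ?thesis using that assms(2) sch'[of t]
      by (auto simp: f_def round_robin_def channel_def split: if_splits)
  qed
  moreover have "\<exists>s\<ge>t. sch' s = Some (i, p)"
    if "i < n" "transit (run A n fl ids sch' t) i p > 0" for t i p
  proof (rule ccontr)
    assume never: "\<not> (\<exists>s\<ge>t. sch' s = Some (i, p))"
    \<comment> \<open>From \<open>t\<close> on the pulse is waiting, from \<open>T\<close> on
      \<open>round_robin\<close> is in force; the turn chosen has to respect both.\<close>
    obtain s where s: "s \<ge> max t T" "channel n s = (i, p)" using channel_recurs \<open>i < n\<close> by blast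
    have "transit (run A n fl ids sch' s) i p > 0"
      by (rule transit_persists[OF that(2)]) (use s never in auto)
    then have "sch' s = Some (i, p)" using s sch'[of s] by (simp add: f_def round_robin_def)
    then show False using never s by auto
  qed
  ultimately have "admissible A n fl ids sch'" by (auto simp: admissible_def)
  then show ?thesis using eq by blast
qed

lemma reachable_imp_admissible:
  assumes "reachable A n fl ids c" "n \<ge> 1"
  shows "\<exists>sch t. admissible A n fl ids sch \<and> run A n fl ids sch t = c"
  using reachable_imp_legal_upto[OF assms(1)] legal_upto_extends_to_admissible[OF _ assms(2)]
  by metis

lemma admissible_imp_reachable:
  assumes "admissible A n fl ids sch"
  shows "reachable A n fl ids (run A n fl ids sch t)"
  by (induction t)
    (use assms in \<open>auto simp: admissible_def intro: reachable.intros split: option.splits\<close>)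

lemma node_output_stable:
  assumes "node_output A ids (run A n fl ids sch t) i = Some d" "t \<le> s"
  shows "node_output A ids (run A n fl ids sch s) i = Some d"
  using assms(2)
proof (induction s rule: dec_induct)
  case base
  then show ?case using assms(1) by simp
next
  case (step s)
  then show ?case
    by (auto simp: deliver_def Let_def node_output_def split: option.splits)
qed

section \<open>Conservation of pulses on oriented rings\<close>

text \<open>Cumulative emissions along a history; the term \<open>m = 0\<close> is the start-up
  event.\<close>

definition emits :: "'id algorithm \<Rightarrow> 'id \<Rightarrow> port list \<Rightarrow> port \<Rightarrow> nat" where
  "emits A v h p = (\<Sum>m\<le>length h. sends A v (take m h) p)"

lemma emits_Nil [simp]: "emits A v [] p = sends A v [] p"
  by (simp add: emits_def)

lemma emits_snoc [simp]: "emits A v (h @ [q]) p = emits A v h p + sends A v (h @ [q]) p"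
  by (simp add: emits_def)

text \<open>The source of the pulses arriving at port \<open>q\<close>: on an oriented ring those
  reaching \<open>Port0\<close> travel clockwise. For \<open>n = 1\<close> it is the node
  itself.\<close>

definition neighbour :: "nat \<Rightarrow> nat \<Rightarrow> port \<Rightarrow> nat" where
  "neighbour n j q = (if q = Port0 then (j + n - 1) mod n else (j + 1) mod n)"

lemma neighbour_less: "j < n \<Longrightarrow> neighbour n j q < n"
  by (simp add: neighbour_def)

lemma mod_succ_eq_iff:
  fixes i j n :: nat
  assumes "i < n" "j < n"
  shows "(i + 1) mod n = j \<longleftrightarrow> i = (j + n - 1) mod n"
proof (cases "i + 1 = n")
  case True
  then show ?thesis using assms by (cases "j = 0") (auto simp: mod_if)
next
  case False
  then show ?thesis using assms by (cases "j = 0") (auto simp: mod_if)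
qed

lemma link_oriented_iff:
  assumes "i < n" "j < n"
  shows "link n oriented (i, p) = (j, q) \<longleftrightarrow> i = neighbour n j q \<and> p = other q"
proof -
  have "(i + n - 1) mod n = j \<longleftrightarrow> i = (j + 1) mod n"
    using mod_succ_eq_iff[OF assms(2,1)] by metis
  then show ?thesis
    using mod_succ_eq_iff[OF assms]
    by (cases p; cases q)
      (simp_all only: link_def cw_port_def oriented_def Let_def neighbour_def prod.case if_False
        if_True prod.inject port.distinct other.simps simp_thms refl)
qed

lemma emitted_to_oriented:
  assumes "i < n" "j < n"
  shows "emitted_to A n oriented ids i h j q =
    (if i = neighbour n j q then sends A (ids i) h (other q) else 0)"
  unfolding emitted_to_def link_oriented_iff[OF assms] by (cases q) auto

text \<open>A pulse emitted into a channel is either still in transit or recorded by the receiver. A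
  terminated receiver discards pulses unrecorded, hence the balance is claimed for undecided
  receivers.\<close>

lemma reachable_conservation:
  assumes "reachable A n oriented ids c"
  shows "sent c = (\<Sum>i<n. \<Sum>p\<in>{Port0, Port1}. emits A (ids i) (hist c i) p)" (is "?P c")
    and "\<And>j q. j < n \<Longrightarrow> decide A (ids j) (hist c j) = None \<Longrightarrow>
      transit c j q + count_list (hist c j) q =
        emits A (ids (neighbour n j q)) (hist c (neighbour n j q)) (other q)" (is "PROP ?Q c")
proof -
  have "?P c \<and> (\<forall>j q. j < n \<longrightarrow> decide A (ids j) (hist c j) = None \<longrightarrow>
      transit c j q + count_list (hist c j) q =
        emits A (ids (neighbour n j q)) (hist c (neighbour n j q)) (other q))"
    using assms
  proof induction
    case reachable_initial
    have "(\<Sum>i<n. emitted_to A n oriented ids i [] j q) =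
        sends A (ids (neighbour n j q)) [] (other q)" if "j < n" for j q
    proof -
      have "(\<Sum>i<n. emitted_to A n oriented ids i [] j q) =
          (\<Sum>i<n. if i = neighbour n j q then sends A (ids i) [] (other q) else 0)"
        using that by (intro sum.cong) (auto simp: emitted_to_oriented)
      then show ?thesis using neighbour_less[OF that] by simp
    qed
    then show ?case by (simp add: initial_def emitted_def)
  next
    case (reachable_deliver c i p)
    show ?case
    proof (cases "decide A (ids i) (hist c i) = None")
      case True
      let ?h = "hist c i @ [p]" and ?c = "deliver A n oriented ids i p c"
      have hist: "hist ?c = (hist c)(i := ?h)"
        and sent: "sent ?c = sent c + emitted A ids i ?h"
        using True by (simp_all add: deliver_def Let_def node_output_def)
      \<comment> \<open>The delivered pulse is added on the left to avoid truncated subtraction;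
        this is sound because \<open>transit c i p > 0\<close>.\<close>
      have transit: "transit ?c j q + (if j = i \<and> q = p then 1 else 0) = transit c j q +
          (if i = neighbour n j q then sends A (ids i) ?h (other q) else 0)" if "j < n" for j q
        using True that reachable_deliver.hyps
        by (auto simp: deliver_def Let_def node_output_def emitted_to_oriented)
      have "(\<Sum>k<n. \<Sum>q\<in>{Port0, Port1}. emits A (ids k) (hist ?c k) q) =
          (\<Sum>k<n. (\<Sum>q\<in>{Port0, Port1}. emits A (ids k) (hist c k) q) +
             (if k = i then emitted A ids i ?h else 0))"
        by (rule sum.cong) (auto simp: hist emitted_def)
      also have "\<dots> = sent ?c"
        using reachable_deliver by (simp add: sum.distrib sent)
      finally have "?P ?c" by simp
      moreover have "transit ?c j q + count_list (hist ?c j) q =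
          emits A (ids (neighbour n j q)) (hist ?c (neighbour n j q)) (other q)"
        if "j < n" "decide A (ids j) (hist ?c j) = None" for j q
      proof -
        have "decide A (ids j) (hist c j) = None"
          using that True by (cases "j = i") (auto simp: hist)
        then have "transit c j q + count_list (hist c j) q =
            emits A (ids (neighbour n j q)) (hist c (neighbour n j q)) (other q)"
          using reachable_deliver.IH \<open>j < n\<close> by blast
        then show ?thesis using transit[OF \<open>j < n\<close>, of q]
          by (auto simp: hist split: if_splits)
      qed
      ultimately show ?thesis by blast
    next
      case False
      then show ?thesis using reachable_deliver
        by (auto simp: deliver_def Let_def node_output_def)
    qed
  qed
  then show "?P c" and "PROP ?Q c" by blast+
qed

section \<open>Solitude words and lockstep executions\<close>

text \<open>
  The words a node with ID \<open>v\<close> can receive, while undecided, on the ring it forms alone: the pulses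
  arriving at a port are those it has emitted through the other one.
\<close>

inductive solitary :: "'id algorithm \<Rightarrow> 'id \<Rightarrow> port list \<Rightarrow> bool" for A v where
  solitary_Nil: "solitary A v []"
| solitary_snoc: "solitary A v h \<Longrightarrow> decide A v h = None \<Longrightarrow>
    count_list h p < emits A v h (other p) \<Longrightarrow> solitary A v (h @ [p])"

lemma solitary_snocD:
  assumes "solitary A v (h @ [p])"
  shows "solitary A v h" "decide A v h = None" "count_list h p < emits A v h (other p)"
  using assms by (auto elim: solitary.cases)

text \<open>Allows a common prefix of several solitude words to be played in lockstep in place of
  the full words.\<close>

lemma solitary_take: "solitary A v h \<Longrightarrow> solitary A v (take m h)"
proof (induction h rule: rev_induct)
  case (snoc p h)
  then show ?case
    by (cases "m \<le> length h") (auto dest: solitary_snocD)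
qed (simp add: solitary_Nil)

lemma count_list_le_emits:
  "solitary A v h \<Longrightarrow> count_list h p \<le> emits A v h (other p)"
  by (induction arbitrary: p rule: solitary.induct) (auto simp: trans_le_add1)

text \<open>A lone node receives only what it has emitted itself. Emissions depend on ID and history
  alone, so the bound carries over to every ring.\<close>

lemma length_le_emits:
  assumes "solitary A v h"
  shows "length h \<le> (\<Sum>p\<in>{Port0, Port1}. emits A v h p)"
proof -
  have "length h = count_list h Port0 + count_list h Port1"
  proof (induction h)
    case (Cons p h)
    then show ?case by (cases p) auto
  qed simp
  then show ?thesis
    using count_list_le_emits[OF assms, of Port0] count_list_le_emits[OF assms, of Port1] by simp
qed

text \<open>With one node, \<open>neighbour\<close> is the node itself, so conservation and a pulse
  in transit give the inequality of \<open>solitary_snoc\<close>.\<close>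

lemma reachable_imp_solitary:
  assumes "reachable A 1 oriented ids c"
  shows "solitary A (ids 0) (hist c 0)"
  using assms
proof induction
  case reachable_initial
  then show ?case by (simp add: initial_def solitary_Nil)
next
  case (reachable_deliver c i p)
  show ?case
  proof (cases "decide A (ids 0) (hist c 0) = None")
    case True
    then have "transit c 0 p + count_list (hist c 0) p = emits A (ids 0) (hist c 0) (other p)"
      using reachable_conservation(2)[OF reachable_deliver.hyps(1), of 0 p]
      by (simp add: neighbour_def)
    then have "count_list (hist c 0) p < emits A (ids 0) (hist c 0) (other p)"
      using reachable_deliver.hyps by simp
    then show ?thesis
      using True reachable_deliver solitary_snoc
      by (auto simp: deliver_def Let_def node_output_def)
  next
    case False
    then show ?thesis using reachable_deliver by (auto simp: deliver_def Let_def node_output_def)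
  qed
qed

text \<open>The word is played letter by letter, each letter being delivered to the nodes
  \<open>0, ..., n - 1\<close> in turn.\<close>

lemma lockstep:
  assumes "\<And>i. i < n \<Longrightarrow> solitary A (ids i) h"
  shows "\<exists>c. reachable A n oriented ids c \<and> (\<forall>i<n. hist c i = h)"
  using assms
proof (induction h rule: rev_induct)
  case Nil
  show ?case by (rule exI[of _ "initial A n oriented ids"])
      (simp add: reachable_initial, simp add: initial_def)
next
  case (snoc p h)
  note sol = solitary_snocD[OF snoc.prems]
  have "\<exists>c. reachable A n oriented ids c \<and> (\<forall>i<n. hist c i = (if i < m then h @ [p] else h))"
    if "m \<le> n" for m
    using that
  proof (induction m)
    case 0
    then show ?case using snoc.IH sol(1) by simp
  next
    case (Suc m)
    then obtain c where c: "reachable A n oriented ids c"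
      "\<And>i. i < n \<Longrightarrow> hist c i = (if i < m then h @ [p] else h)" by auto
    let ?k = "neighbour n m p"
    have m: "m < n" "?k < n" using Suc.prems neighbour_less by auto
    have "transit c m p + count_list h p = emits A (ids ?k) (hist c ?k) (other p)"
      using reachable_conservation(2)[OF c(1) m(1), of p] c(2)[OF m(1)] sol(2)[OF m(1)] by simp
    \<comment> \<open>The neighbour may already have received the extra letter \<open>p\<close>,
      which can only add emissions. Its own solitary run supplies the strict inequality for
      \<open>h\<close>.\<close>
    moreover have "emits A (ids ?k) h (other p) \<le> emits A (ids ?k) (hist c ?k) (other p)"
      using c(2)[OF m(2)] by simp
    ultimately have "transit c m p > 0" using sol(3)[OF m(2)] by linarith
    then have "reachable A n oriented ids (deliver A n oriented ids m p c)"
      using c(1) m(1) by (rule reachable_deliver[rotated 2])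
    moreover have "hist (deliver A n oriented ids m p c) i = (if i < Suc m then h @ [p] else h)"
      if "i < n" for i
      using c(2)[OF that] c(2)[OF m(1)] sol(2)[OF m(1)]
      by (auto simp: deliver_def Let_def node_output_def)
    ultimately show ?case by blast
  qed
  from this[of n] show ?case by auto
qed

section \<open>Existence and distinctness of solitude words\<close>

text \<open>The time \<open>s\<close> witnessing an election may precede \<open>t\<close>, but all
  nodes have decided by then and verdicts are permanent, so both leaders are present at
  \<open>s\<close>.\<close>

lemma two_leaders_not_elects_leader:
  assumes "node_output A ids (run A n fl ids sch t) i = Some Leader" "i < n"
    and "node_output A ids (run A n fl ids sch t) j = Some Leader" "j < n" "i \<noteq> j"
  shows "\<not> elects_leader A n fl ids sch"
proof
  assume "elects_leader A n fl ids sch"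
  then obtain s where s: "\<forall>k<n. node_output A ids (run A n fl ids sch s) k \<noteq> None"
    "\<exists>!k. k < n \<and> node_output A ids (run A n fl ids sch s) k = Some Leader"
    unfolding elects_leader_def by blast
  have "node_output A ids (run A n fl ids sch s) k = Some Leader"
    if "node_output A ids (run A n fl ids sch t) k = Some Leader" "k < n" for k
  proof -
    obtain d where d: "node_output A ids (run A n fl ids sch s) k = Some d"
      using s(1) \<open>k < n\<close> by blast
    show ?thesis
      using node_output_stable[OF that(1), of "max s t"] node_output_stable[OF d, of "max s t"] d
      by simp
  qed
  then show False using s(2) assms by blast
qed

lemma ex_solitude_word:
  assumes "leader_election_algorithm A Lab IDs" "oriented \<in> Lab" "v \<in> IDs"
  shows "\<exists>h. solitary A v h \<and> decide A v h = Some Leader"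
proof -
  let ?ids = "\<lambda>_. v"
  obtain sch where sch: "admissible A 1 oriented ?ids sch"
    using reachable_imp_admissible[OF reachable_initial] by blast
  have "id_assignment 1 IDs ?ids" using assms(3) by (auto simp: id_assignment_def inj_on_def)
  then have "elects_leader A 1 oriented ?ids sch"
    using assms sch unfolding leader_election_algorithm_def by blast
  then obtain t where "decide A v (hist (run A 1 oriented ?ids sch t) 0) = Some Leader"
    unfolding elects_leader_def node_output_def by auto
  then show ?thesis
    using reachable_imp_solitary[OF admissible_imp_reachable[OF sch]] by blast
qed

text \<open>Otherwise \<open>lockstep\<close> on the ring of the two nodes \<open>v\<close> and
  \<open>w\<close> would give both of them the history \<open>h\<close>, and both would be
  leader.\<close>

lemma solitude_words_distinct:
  assumes "leader_election_algorithm A Lab IDs" "oriented \<in> Lab" "v \<in> IDs" "w \<in> IDs"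
    and "solitary A v h" "decide A v h = Some Leader"
    and "solitary A w h" "decide A w h = Some Leader"
  shows "v = w"
proof (rule ccontr)
  assume "v \<noteq> w"
  let ?ids = "\<lambda>i::nat. if i = 0 then v else w"
  have ids: "id_assignment 2 IDs ?ids"
    using \<open>v \<noteq> w\<close> assms(3,4) by (auto simp: id_assignment_def inj_on_def less_2_cases_iff)
  have "solitary A (?ids i) h" for i using assms(5,7) by simp
  then obtain c where c: "reachable A 2 oriented ?ids c" "\<forall>i<2. hist c i = h"
    using lockstep[of 2 A ?ids h] by blast
  then obtain sch t where sch: "admissible A 2 oriented ?ids sch" "run A 2 oriented ?ids sch t = c"
    using reachable_imp_admissible[OF c(1)] by auto
  have "\<not> elects_leader A 2 oriented ?ids sch"
    by (rule two_leaders_not_elects_leader[where t = t and i = 0 and j = 1])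
      (use c(2) sch(2) assms(6,8) in \<open>auto simp: node_output_def\<close>)
  moreover have "elects_leader A 2 oriented ?ids sch"
    using assms(1,2) ids sch(1) unfolding leader_election_algorithm_def by fastforce
  ultimately show False by blast
qed

section \<open>Counting prefixes\<close>

lemma UNIV_port: "(UNIV :: port set) = {Port0, Port1}"
  using port.exhaust by auto

lemma card_port_lists: "finite {w :: port list. length w = L}" "card {w :: port list. length w = L} = 2 ^ L"
proof -
  have fin: "finite (UNIV :: port set)" and card: "card (UNIV :: port set) = 2"
    by (simp_all add: UNIV_port)
  show "finite {w :: port list. length w = L}" using finite_lists_length_eq[OF fin, of L] by simp
  show "card {w :: port list. length w = L} = 2 ^ L"
    using card_lists_length_eq[OF fin, of L] card by simp
qed

text \<open>The count is \<open>1 + 2 + ... + 2 ^ (L - 1)\<close>; its strictness is what closes the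
  pigeonhole argument of \<open>common_prefix\<close>.\<close>

lemma card_port_lists_less:
  "finite {w :: port list. length w < L}" "card {w :: port list. length w < L} < 2 ^ L"
proof -
  have "finite {w :: port list. length w < L} \<and> card {w :: port list. length w < L} < 2 ^ L"
  proof (induction L)
    case (Suc L)
    have split: "{w :: port list. length w < Suc L} = {w. length w < L} \<union> {w. length w = L}" by auto
    show ?case
      using Suc card_port_lists[of L]
        card_Un_le[of "{w :: port list. length w < L}" "{w. length w = L}"]
      by (simp add: split)
  qed simp
  then show "finite {w :: port list. length w < L}" "card {w :: port list. length w < L} < 2 ^ L"
    by auto
qed

text \<open>Pigeonhole: if each of the \<open>2 ^ L\<close> fibers had at most \<open>n - 1\<close>
  elements, then together with the fewer than \<open>2 ^ L\<close> short words \<open>S\<close>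
  would have fewer than \<open>n * 2 ^ L\<close> elements.\<close>

lemma common_prefix:
  fixes P :: "'a \<Rightarrow> port list"
  assumes "finite S" "inj_on P S" "n * 2 ^ L \<le> card S" "n \<ge> 1"
  shows "\<exists>T w. T \<subseteq> S \<and> card T = n \<and> length w = L \<and> (\<forall>a\<in>T. take L (P a) = w)"
proof -
  define fiber where "fiber w = {a \<in> S. take L (P a) = w}" for w
  define short where "short = {a \<in> S. length (P a) < L}"
  have "\<exists>w. length w = L \<and> n \<le> card (fiber w)"
  proof (rule ccontr)
    assume "\<not> (\<exists>w. length w = L \<and> n \<le> card (fiber w))"
    then have small: "card (fiber w) \<le> n - 1" if "length w = L" for w
      using that assms(4) by (metis Suc_pred' less_Suc_eq_le not_le less_le_trans zero_less_one)
    have "card short = card (P ` short)"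
      using assms(2) by (intro card_image[symmetric]) (auto simp: short_def inj_on_def)
    also have "\<dots> \<le> card {w :: port list. length w < L}"
      by (intro card_mono card_port_lists_less) (auto simp: short_def)
    finally have "card short < 2 ^ L" using card_port_lists_less(2)[of L] by simp
    moreover have "card (\<Union>w\<in>{w. length w = L}. fiber w) \<le> (n - 1) * 2 ^ L"
    proof -
      have "card (\<Union>w\<in>{w. length w = L}. fiber w) \<le> (\<Sum>w\<in>{w. length w = L}. card (fiber w))"
        by (rule card_UN_le[OF card_port_lists(1)])
      also have "\<dots> \<le> (\<Sum>w\<in>{w :: port list. length w = L}. n - 1)"
        by (intro sum_mono small) simp
      finally show ?thesis by (simp add: card_port_lists(2) mult.commute)
    qed
    moreover have "S = short \<union> (\<Union>w\<in>{w. length w = L}. fiber w)"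
      by (auto simp: short_def fiber_def)
    then have "card S \<le> card short + card (\<Union>w\<in>{w. length w = L}. fiber w)"
      using card_Un_le by metis
    ultimately have "card S < 2 ^ L + (n - 1) * 2 ^ L" by linarith
    also have "\<dots> = n * 2 ^ L" using assms(4) by (cases n) auto
    finally show False using assms(3) by simp
  qed
  then obtain w where w: "length w = L" "n \<le> card (fiber w)" by blast
  then obtain T where "T \<subseteq> fiber w" "card T = n" using obtain_subset_with_card_n by metis
  moreover from this(1) have "T \<subseteq> S" "\<forall>a\<in>T. take L (P a) = w" by (auto simp: fiber_def)
  ultimately show ?thesis using w(1) by blast
qed

section \<open>The lower bound on the number of pulses\<close>

text \<open>Working with a finite \<open>S\<close> inside \<open>IDs\<close> covers finite and
  infinite supplies alike.\<close>

lemma lower_bound_pow2: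
  assumes "leader_election_algorithm A Lab IDs" "oriented \<in> Lab"
    and "S \<subseteq> IDs" "finite S" "n * 2 ^ L \<le> card S" "n \<ge> 1"
  shows "\<exists>ids sch. id_assignment n IDs ids \<and> admissible A n oriented ids sch \<and>
    sends_at_least A n oriented ids sch (n * L)"
proof -
  have "\<forall>v\<in>IDs. \<exists>h. solitary A v h \<and> decide A v h = Some Leader"
    using ex_solitude_word[OF assms(1,2)] by blast
  from bchoice[OF this] obtain P
    where P: "\<And>v. v \<in> IDs \<Longrightarrow> solitary A v (P v) \<and> decide A v (P v) = Some Leader"
    by blast
  have "inj_on P S"
  proof (rule inj_onI)
    fix v w assume "v \<in> S" "w \<in> S" "P v = P w"
    then show "v = w"
      using P[of v] P[of w] assms(3) solitude_words_distinct[OF assms(1,2), of v w "P v"] by auto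
  qed
  from common_prefix[OF assms(4) this assms(5,6)] obtain T w
    where T: "T \<subseteq> S" "card T = n" "length w = L" "\<forall>a\<in>T. take L (P a) = w"
    by blast
  have "finite T" using T(1) assms(4) finite_subset by blast
  then obtain ids where "bij_betw ids {0..<n} T" using ex_bij_betw_nat_finite T(2) by blast
  then have ids: "inj_on ids {..<n}" "ids ` {..<n} = T"
    by (simp_all add: bij_betw_def atLeast0LessThan)
  have sol: "solitary A (ids i) w" if "i < n" for i
  proof -
    have "ids i \<in> T" using that ids(2) by blast
    then have "solitary A (ids i) (P (ids i))" "take L (P (ids i)) = w" using T P assms(3) by auto
    then show ?thesis using solitary_take by metis
  qed
  then obtain c where c: "reachable A n oriented ids c" "\<forall>i<n. hist c i = w"
    using lockstep[of n A ids w] by blast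
  obtain sch t where sch: "admissible A n oriented ids sch" "run A n oriented ids sch t = c"
    using reachable_imp_admissible[OF c(1) assms(6)] by blast
  \<comment> \<open>Each of the \<open>n\<close> nodes has history \<open>w\<close>, along which it
    has emitted at least \<open>L\<close> pulses.\<close>
  have "n * L = (\<Sum>i<n. length w)" using T(3) by simp
  also have "\<dots> \<le> (\<Sum>i<n. \<Sum>p\<in>{Port0, Port1}. emits A (ids i) (hist c i) p)"
    by (rule sum_mono) (metis c(2) sol length_le_emits lessThan_iff)
  also have "\<dots> = sent c" using reachable_conservation(1)[OF c(1)] by simp
  finally have "sends_at_least A n oriented ids sch (n * L)"
    using sch(2) unfolding sends_at_least_def by blast
  moreover have "id_assignment n IDs ids" using ids T(1) assms(3) by (auto simp: id_assignment_def)
  ultimately show ?thesis using sch(1) by blast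
qed

lemma pow2_floor_log_le:
  assumes "n \<ge> 1" "n \<le> k"
  shows "n * 2 ^ nat \<lfloor>log 2 (real k / real n)\<rfloor> \<le> k"
proof -
  let ?x = "real k / real n"
  have x: "?x \<ge> 1" using assms by simp
  \<comment> \<open>Nonnegativity ensures that \<open>nat\<close> does not round the floor up to
    zero.\<close>
  then have nonneg: "log 2 ?x \<ge> 0" by (subst zero_le_log_cancel_iff) auto
  have "(2::real) ^ nat \<lfloor>log 2 ?x\<rfloor> = 2 powr real (nat \<lfloor>log 2 ?x\<rfloor>)"
    by (rule powr_realpow[symmetric]) simp
  also have "\<dots> \<le> 2 powr log 2 ?x"
    using nonneg by (intro powr_mono of_nat_floor) auto
  also have "\<dots> = ?x" by (rule powr_log_cancel) (use x in linarith)+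
  finally have "real n * 2 ^ nat \<lfloor>log 2 ?x\<rfloor> \<le> real k"
    using assms(1) by (simp add: field_simps)
  then have "real (n * 2 ^ nat \<lfloor>log 2 ?x\<rfloor>) \<le> real k" by simp
  then show ?thesis by (simp only: of_nat_le_iff)
qed

theorem theorem5p1:
  fixes A :: "'id algorithm" and Lab :: "labelling set" and IDs :: "'id set"
  assumes "oriented \<in> Lab"
    and "leader_election_algorithm A Lab IDs"
  shows "(\<forall>k n :: nat. k \<ge> 1 \<and> n \<ge> 1 \<and> k \<ge> n \<and> card IDs = k \<longrightarrow>
            (\<exists>ids sch. id_assignment n IDs ids \<and> admissible A n oriented ids sch \<and>
               sends_at_least A n oriented ids sch (n * nat \<lfloor>log 2 (real k / real n)\<rfloor>)))
       \<and> (infinite IDs \<longrightarrow>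
            (\<forall>n \<ge> 1. \<forall>B :: nat. \<exists>ids sch. id_assignment n IDs ids \<and> admissible A n oriented ids sch \<and>
               sends_at_least A n oriented ids sch B))"
proof (intro conjI allI impI, goal_cases)
  case (1 k n)
  \<comment> \<open>An infinite set has \<open>card\<close> equal to 0, which
    \<open>k \<ge> 1\<close> excludes.\<close>
  then have "finite IDs" by (auto intro: card_ge_0_finite)
  then show ?case
    using 1 pow2_floor_log_le[of n k] by (intro lower_bound_pow2[OF assms(2,1) subset_refl]) auto
next
  case (2 n B)
  \<comment> \<open>Taking \<open>L = B\<close> yields \<open>n * B\<close> pulses, at least
    \<open>B\<close> since \<open>n \<ge> 1\<close>.\<close>
  obtain S where S: "S \<subseteq> IDs" "finite S" "card S = n * 2 ^ B"
    using infinite_arbitrarily_large[OF 2(1)] by metis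
  have "B \<le> n * B" using 2(2) by simp
  moreover obtain ids sch where "id_assignment n IDs ids" "admissible A n oriented ids sch"
    "sends_at_least A n oriented ids sch (n * B)"
    using lower_bound_pow2[OF assms(2,1) S(1,2) _ 2(2), of B] S(3) by auto
  ultimately show ?case unfolding sends_at_least_def by (meson le_trans)
qed

end
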